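(* Let $0<q<1$, let $r\ge 0$ and $n \geq 0$ be integers, and let $p(x)\in\mathbb{C}[x]$ be a polynomial of degree at most $n$, written as $p(x)=\sum_{k=0}^{n}b_{k,q}^{r}E_{k,q}^{(r)}(x)$ in terms of the $q$-Euler polynomials of order $r$ defined in the context. Then for $0\le k\le n$, $$b_{k,q}^{r}=\frac{1}{2^r[k]_q!}\left\langle \left( e_q(t)+1\right)^r t^k \,\big\vert\, p(x)\right\rangle =\frac{1}{2^r[k]_q!}\sum_{m \geq 0}\sum_{l=0}^{r}\binom{r}{l} \sum_{\substack{i_1+ \cdots +i_l=m\\ i_1,\dots,i_l\ge0}}\binom{m}{i_1, \cdots , i_l}_q \frac{1}{[m]_q!} p^{(m+k)}(0),$$ where $p^{(j)}(x)=D^j_q p(x)$ and $\binom{m}{i_1, \cdots , i_l}_q=\frac{[m]_q!}{[i_1]_q!\cdots[i_l]_q!}$.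
   Context: Fix a real number $q$ with $0<q<1$. For an integer $n\ge 0$ set $[n]_q=\frac{1-q^n}{1-q}$, $[0]_q!=1$, $[n]_q!=[1]_q\cdots[n]_q$. Let $e_q(z)=\sum_{n=0}^{\infty}\frac{z^n}{[n]_q!}$. For an integer $r\ge0$, the $q$-Euler polynomials of order $r$ are defined by the formal power series identity $\left(\frac{2}{e_q(t)+1}\right)^r e_q(xt)=\sum_{n\ge0}E^{(r)}_{n,q}(x)\frac{t^n}{[n]_q!}$. The $q$-derivative is $D_qf(x)=\frac{f(x)-f(qx)}{(1-q)x}$ for $x\ne0$ and $D_qf(0)=f'(0)$; on polynomials $D_qx^n=[n]_qx^{n-1}$. For a formal power series $f(t)=\sum_{k\ge0}\frac{a_k}{[k]_q!}t^k$ with complex coefficients, the linear functional $\langle f(t)\,|\,\cdot\,\rangle$ on $\mathbb{C}[x]$ is defined by $\langle f(t)\,|\,x^n\rangle=a_n$, extended linearly; $(e_q(t)+1)^rt^k$ is a product of formal power series. For $l=0$ the sum over $i_1+\cdots+i_0=m$ is understood as $1$ if $m=0$ and $0$ otherwise. *)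

theory Defs
  imports "HOL-Analysis.Analysis" "HOL-Computational_Algebra.Computational_Algebra"
begin

definition qnum :: "real \<Rightarrow> nat \<Rightarrow> real" where
  "qnum q n = (1 - q ^ n) / (1 - q)"

definition qfact :: "real \<Rightarrow> nat \<Rightarrow> real" where
  "qfact q n = (\<Prod>i=1..n. qnum q i)"

definition qmultinomial :: "real \<Rightarrow> nat \<Rightarrow> nat list \<Rightarrow> real" where
  "qmultinomial q m is = qfact q m / (\<Prod>i\<leftarrow>is. qfact q i)"

definition qexp :: "real \<Rightarrow> complex fps" where
  "qexp q = Abs_fps (\<lambda>n. 1 / of_real (qfact q n))"

(* Power series in t over C[x]. The first factor is (2/(e_q(t)+1))^r, computed in C[[t]] and
   embedded coefficientwise as constant polynomials; the second is e_q(xt). *)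
definition qEuler_gf :: "real \<Rightarrow> nat \<Rightarrow> complex poly fps" where
  "qEuler_gf q r =
     Abs_fps (\<lambda>n. [:fps_nth ((2 / (qexp q + 1)) ^ r) n:]) *
     Abs_fps (\<lambda>n. monom (1 / of_real (qfact q n)) n)"

definition qEuler :: "real \<Rightarrow> nat \<Rightarrow> nat \<Rightarrow> complex poly" where
  "qEuler q r n = smult (of_real (qfact q n)) (fps_nth (qEuler_gf q r) n)"

definition qderiv :: "real \<Rightarrow> (complex \<Rightarrow> complex) \<Rightarrow> complex \<Rightarrow> complex" where
  "qderiv q f x =
     (if x = 0 then deriv f 0 else (f x - f (of_real q * x)) / ((1 - of_real q) * x))"

(* If f(t) = sum_k a_k t^k / [k]_q!, then a_k = [k]_q! * fps_nth f k. *)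
definition qfunctional :: "real \<Rightarrow> complex fps \<Rightarrow> complex poly \<Rightarrow> complex" where
  "qfunctional q f p = (\<Sum>k\<le>degree p. coeff p k * (of_real (qfact q k) * fps_nth f k))"

lemma qnum_pos:
  assumes "0 < q" "q < 1" "0 < n"
  shows "0 < qnum q n"
  using assms by (simp add: qnum_def power_less_one_iff)

lemma qfact_pos:
  assumes "0 < q" "q < 1"
  shows "0 < qfact q n"
  unfolding qfact_def using assms by (intro prod_pos) (auto intro: qnum_pos)

lemma qEuler_gf_conv_qEuler:
  assumes "0 < q" "q < 1"
  shows "qEuler_gf q r = Abs_fps (\<lambda>n. smult (1 / of_real (qfact q n)) (qEuler q r n))"
proof (rule fps_ext)
  fix n
  have "qfact q n \<noteq> 0"
    using qfact_pos[OF assms, of n] by simp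
  then show "fps_nth (qEuler_gf q r) n
      = fps_nth (Abs_fps (\<lambda>n. smult (1 / of_real (qfact q n)) (qEuler q r n))) n"
    by (simp add: qEuler_def)
qed

lemma qfunctional_bound:
  assumes "degree p \<le> N"
  shows "qfunctional q f p = (\<Sum>k\<le>N. coeff p k * (of_real (qfact q k) * fps_nth f k))"
  unfolding qfunctional_def using assms
  by (intro sum.mono_neutral_left) (auto simp: coeff_eq_0)

lemma qfunctional_monom:
  "qfunctional q f (monom c n) = c * (of_real (qfact q n) * fps_nth f n)"
  by (simp add: qfunctional_bound[OF degree_monom_le] if_distrib[of "\<lambda>x. x * _"] cong: if_cong)

lemma qfunctional_add:
  "qfunctional q f (p + p') = qfunctional q f p + qfunctional q f p'"
proof -
  let ?N = "max (degree p) (degree p')"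
  have "degree (p + p') \<le> ?N"
    by (rule degree_add_le_max)
  then show ?thesis
    by (simp add: qfunctional_bound[of _ ?N] sum.distrib distrib_right)
qed

lemma qfunctional_smult:
  "qfunctional q f (smult c p) = c * qfunctional q f p"
  by (simp add: qfunctional_bound[of _ "degree p"] sum_distrib_left mult.assoc)

lemma qderiv_poly_monom:
  assumes "0 < q" "q < 1"
  shows "qderiv q (poly (monom 1 n)) = poly (monom (of_real (qnum q n)) (n - 1))"
proof
  fix x :: complex
  have q1: "1 - complex_of_real q \<noteq> 0"
    using assms by (metis of_real_eq_1_iff right_minus_eq less_irrefl)
  show "qderiv q (poly (monom 1 n)) x = poly (monom (of_real (qnum q n)) (n - 1)) x"
  proof (cases "x = 0")
    case True
    have "deriv (poly (monom 1 n)) (0::complex) = poly (pderiv (monom 1 n)) 0"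
      by (rule DERIV_imp_deriv) (rule poly_DERIV)
    then show ?thesis
      using True q1 assms
      by (cases n; cases "n - 1") (auto simp: qderiv_def pderiv_monom poly_monom qnum_def)
  next
    case False
    then show ?thesis
      using q1
      by (cases n) (auto simp: qderiv_def poly_monom qnum_def power_mult_distrib field_simps)
  qed
qed

lemma finite_compositions: "finite {is :: nat list. length is = l \<and> sum_list is = m}"
proof (rule finite_subset)
  show "{is. length is = l \<and> sum_list is = m} \<subseteq> {is. set is \<subseteq> {..m} \<and> length is = l}"
    by (auto dest: member_le_sum_list)
  show "finite {is. set is \<subseteq> {..m} \<and> length is = l}"
    by (rule finite_lists_length_eq) simp
qed

end

theory Submission
  imports Defs
begin

text \<open>
  Applying a functional f(t) to the generating function of the q-Euler polynomials turns
  e_q(xt) into f(t), so f(t) sends the j-th polynomial to [j]! times the j-th coefficient of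
  f(t) (2/(e_q(t)+1))^r. For f(t) = (e_q(t)+1)^r t^k this product is 2^r t^k, which gives
  biorthogonality and hence the first formula. The second formula follows from the q-Taylor
  coefficients D_q^j p(0) = [j]! p_j and the binomial expansion of (e_q(t)+1)^r.
\<close>

text \<open>In \<open>e_q(xt)\<close> the power \<open>x^i\<close> occurs only together with
  \<open>t^i\<close>, so a single term of the Cauchy product survives, the one with index
  \<open>j - i\<close>.\<close>

lemma coeff_qEuler:
  "coeff (qEuler q r j) i =
     (if i \<le> j then of_real (qfact q j) * fps_nth ((2 / (qexp q + 1)) ^ r) (j - i) / of_real (qfact q i)
      else 0)"
proof -
  have "coeff (fps_nth (qEuler_gf q r) j) i =
      (\<Sum>s=0..j. if j - s = i
        then fps_nth ((2 / (qexp q + 1)) ^ r) s / of_real (qfact q i) else 0)"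
    by (auto simp: qEuler_gf_def fps_mult_nth coeff_sum intro!: sum.cong)
  \<comment> \<open>The condition is solved for \<open>s\<close> so that the sum collapses; the
    conjunct \<open>i \<le> j\<close> guards against truncated subtraction.\<close>
  also have "\<dots> = (\<Sum>s\<in>{0..j}. if s = j - i \<and> i \<le> j
        then fps_nth ((2 / (qexp q + 1)) ^ r) s / of_real (qfact q i) else 0)"
    by (rule sum.cong) auto
  also have "\<dots> = (if i \<le> j
      then fps_nth ((2 / (qexp q + 1)) ^ r) (j - i) / of_real (qfact q i) else 0)"
    by (cases "i \<le> j") (simp_all add: sum.delta)
  finally show ?thesis
    by (simp add: qEuler_def)
qed

lemma degree_qEuler_le: "degree (qEuler q r j) \<le> j"
  by (rule degree_le) (simp add: coeff_qEuler)

text \<open>The weight \<open>[i]_q!\<close> in the functional cancels the denominator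
  \<open>[i]_q!\<close> in the coefficient of \<open>x^i\<close>; what remains is a Cauchy
  product.\<close>

lemma qfunctional_qEuler:
  assumes "0 < q" "q < 1"
  shows "qfunctional q f (qEuler q r j) =
    of_real (qfact q j) * fps_nth (f * (2 / (qexp q + 1)) ^ r) j"
proof -
  have nz: "qfact q i \<noteq> 0" for i
    using qfact_pos[OF assms, of i] by simp
  show ?thesis
    unfolding qfunctional_bound[OF degree_qEuler_le] fps_mult_nth sum_distrib_left atMost_atLeast0
    by (rule sum.cong) (simp_all add: coeff_qEuler nz)
qed

lemma qfunctional_sum:
  "qfunctional q f (\<Sum>j\<in>A. P j) = (\<Sum>j\<in>A. qfunctional q f (P j))"
proof (induction A rule: infinite_finite_induct)
  case (insert x A)
  then show ?case
    by (simp add: qfunctional_add)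
qed (simp_all add: qfunctional_def)

text \<open>The constant term of \<open>e_q(t) + 1\<close> is 2, so the series is a unit and the
  division is exact.\<close>

lemma qexp_plus_one_power_mult_inverse:
  "(qexp q + 1) ^ r * (2 / (qexp q + 1)) ^ r = 2 ^ r"
proof -
  have "fps_nth (qexp q + 1) 0 \<noteq> 0"
    by (simp add: qexp_def qfact_def)
  then have "is_unit (qexp q + 1)"
    by simp
  then have "(qexp q + 1) * (2 / (qexp q + 1)) = 2"
    by (simp add: unit_imp_dvd)
  then show ?thesis
    by (metis power_mult_distrib)
qed

lemma qfunctional_qEuler_biorthogonal:
  assumes "0 < q" "q < 1"
  shows "qfunctional q ((qexp q + 1) ^ r * fps_X ^ k) (qEuler q r j) =
    (if j = k then 2 ^ r * of_real (qfact q k) else 0)"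
proof -
  have "(qexp q + 1) ^ r * fps_X ^ k * (2 / (qexp q + 1)) ^ r =
      ((qexp q + 1) ^ r * (2 / (qexp q + 1)) ^ r) * fps_X ^ k"
    by (simp only: mult_ac)
  also have "\<dots> = fps_const (2 ^ r) * fps_X ^ k"
    unfolding qexp_plus_one_power_mult_inverse
    by (simp add: fps_numeral_fps_const fps_const_power)
  finally have eq: "(qexp q + 1) ^ r * fps_X ^ k * (2 / (qexp q + 1)) ^ r =
      fps_const (2 ^ r) * fps_X ^ k" .
  show ?thesis
    unfolding qfunctional_qEuler[OF assms] eq by (simp add: fps_X_power_nth)
qed

text \<open>Producing a polynomial again is what allows \<open>qderiv\<close> to be
  iterated.\<close>

lemma qderiv_poly:
  assumes "0 < q" "q < 1"
  obtains p' where "qderiv q (poly p) = poly p'"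
    and "\<And>i. coeff p' i = of_real (qnum q (Suc i)) * coeff p (Suc i)"
proof -
  have q1: "1 - complex_of_real q \<noteq> 0"
    using assms by (metis of_real_eq_1_iff right_minus_eq less_irrefl)
  obtain a s where p: "p = pCons a s"
    by (cases p)
  \<comment> \<open>With \<open>p(x) = a + x s(x)\<close> the constant cancels in
    \<open>p(x) - p(qx)\<close> and a factor \<open>x\<close> comes out, leaving
    \<open>(s(x) - q s(qx)) / (1 - q)\<close>. Its value at 0 is \<open>s(0)\<close>, the ordinary
    derivative there.\<close>
  define p' where "p' = smult (1 / (1 - of_real q))
    (s - smult (of_real q) (pcompose s [:0, of_real q:]))"
  have "qderiv q (poly p) x = poly p' x" for x
  proof (cases "x = 0")
    case True
    have "deriv (poly p) (0::complex) = poly (pderiv p) 0"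
      by (rule DERIV_imp_deriv) (rule poly_DERIV)
    then show ?thesis
      using True q1 by (simp add: qderiv_def p p'_def pderiv_pCons poly_pcompose field_simps)
  next
    case False
    then show ?thesis
      using q1 by (simp add: qderiv_def p p'_def poly_pcompose field_simps)
  qed
  moreover have "coeff p' i = of_real (qnum q (Suc i)) * coeff p (Suc i)" for i
    using q1 by (simp add: p p'_def coeff_pcompose_linear qnum_def field_simps)
  ultimately show ?thesis
    using that by blast
qed

lemma qfact_Suc: "qfact q (Suc n) = qnum q (Suc n) * qfact q n"
  by (simp add: qfact_def)

lemma qderiv_funpow_poly_0:
  assumes "0 < q" "q < 1"
  shows "(qderiv q ^^ j) (poly p) 0 = of_real (qfact q j) * coeff p j"
proof (induction j arbitrary: p)
  case 0
  then show ?case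
    by (simp add: qfact_def poly_0_coeff_0)
next
  case (Suc j)
  obtain p' where "qderiv q (poly p) = poly p'"
    and "\<And>i. coeff p' i = of_real (qnum q (Suc i)) * coeff p (Suc i)"
    using qderiv_poly[OF assms] by blast
  \<comment> \<open>The innermost derivative is peeled off, so the induction hypothesis is used for
    \<open>p'\<close>.\<close>
  then show ?case
    by (simp add: funpow_Suc_right Suc.IH qfact_Suc del: funpow.simps)
qed

text \<open>An \<open>l\<close>-fold Cauchy product runs over the lists of length \<open>l\<close>
  with sum \<open>m\<close>, and the factors \<open>1 / [i]_q!\<close> multiply to the multinomial
  divided by \<open>[m]_q!\<close>.\<close>

lemma fps_nth_qexp_power:
  assumes "0 < q" "q < 1"
  shows "fps_nth (qexp q ^ l) m =
    (\<Sum>is | length is = l \<and> sum_list is = m.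
      of_real (qmultinomial q m is) * (1 / of_real (qfact q m)))"
proof -
  have nz: "qfact q m \<noteq> 0"
    using qfact_pos[OF assms, of m] by simp
  have "(\<Sum>is | length is = l \<and> sum_list is = m.
        of_real (qmultinomial q m is) * (1 / of_real (qfact q m)))
      = (\<Sum>is\<in>natpermute m l. \<Prod>i\<leftarrow>is. fps_nth (qexp q) i)"
  proof (rule sum.cong)
    fix "is" :: "nat list"
    have "(\<Prod>i\<leftarrow>is. fps_nth (qexp q) i) = 1 / of_real (\<Prod>i\<leftarrow>is. qfact q i)"
      by (induction "is") (simp_all add: qexp_def)
    then show "of_real (qmultinomial q m is) * (1 / of_real (qfact q m)) =
        (\<Prod>i\<leftarrow>is. fps_nth (qexp q) i)"
      using nz by (simp add: qmultinomial_def)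
  qed (simp add: natpermute_def)
  also have "\<dots> = fps_nth (qexp q ^ l) m"
  \<comment> \<open>The product over positions \<open>0..l - 1\<close> is the right one only for
    positive \<open>l\<close>; for \<open>l = 0\<close> only the empty list can occur.\<close>
  proof (cases l)
    case 0
    then show ?thesis
      by (simp add: natpermute_0)
  next
    case (Suc l')
    have "(\<Prod>i\<leftarrow>is. fps_nth (qexp q) i) = (\<Prod>j=0..l'. fps_nth (qexp q) (is ! j))"
      if "is \<in> natpermute m l" for "is"
      using that Suc
      by (auto simp: natpermute_def prod.list_conv_set_nth atLeastLessThanSuc_atLeastAtMost
          intro!: prod.cong)
    then show ?thesis
      using Suc by (simp add: fps_power_nth del: power_Suc)
  qed
  finally show ?thesis ..
qed

lemma fps_nth_qexp_plus_one_power: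
  assumes "0 < q" "q < 1"
  shows "fps_nth ((qexp q + 1) ^ r) m =
    (\<Sum>l=0..r. of_nat (r choose l) *
      (\<Sum>is | length is = l \<and> sum_list is = m.
        of_real (qmultinomial q m is) * (1 / of_real (qfact q m))))"
proof -
  have "fps_nth (of_nat c * f) m = of_nat c * fps_nth f m" for c and f :: "complex fps"
    by (metis fps_mult_left_const_nth fps_of_nat)
  then show ?thesis
    by (simp only: binomial_ring fps_sum_nth atMost_atLeast0 mult.assoc power_one mult_1_right
        fps_nth_qexp_power[OF assms])
qed

text \<open>The series is in fact finite, since the iterated derivatives at 0 are multiples of the
  coefficients of \<open>p\<close>. The factor \<open>t^k\<close> accounts for the shift by
  \<open>k\<close>.\<close>

lemma qfunctional_mult_X_power_sums:
  assumes "0 < q" "q < 1"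
  shows "(\<lambda>m. fps_nth f m * (qderiv q ^^ (m + k)) (poly p) 0) sums
    qfunctional q (f * fps_X ^ k) p"
proof -
  let ?h = "\<lambda>i. coeff p i * (of_real (qfact q i) * fps_nth (f * fps_X ^ k) i)"
  have "(\<lambda>m. ?h (m + k)) sums (\<Sum>m\<le>degree p. ?h (m + k))"
    by (rule sums_finite) (auto simp: coeff_eq_0)
  also have "(\<Sum>m\<le>degree p. ?h (m + k)) = (\<Sum>i\<in>{k..degree p + k}. ?h i)"
    by (rule sum.reindex_bij_witness[of _ "\<lambda>i. i - k" "\<lambda>m. m + k"]) auto
  \<comment> \<open>Indices below \<open>k\<close> contribute nothing because of the factor
    \<open>fps_X ^ k\<close>.\<close>
  also have "\<dots> = (\<Sum>i\<le>degree p + k. ?h i)"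
    by (rule sum.mono_neutral_left) (auto simp: fps_X_power_mult_right_nth)
  also have "\<dots> = qfunctional q (f * fps_X ^ k) p"
    by (rule qfunctional_bound[symmetric]) simp
  finally show ?thesis
    by (simp add: qderiv_funpow_poly_0[OF assms] fps_X_power_mult_right_nth mult_ac)
qed

theorem theorem7:
  fixes q :: real and r n k :: nat and p :: "complex poly" and b :: "nat \<Rightarrow> complex"
  assumes "0 < q" and "q < 1"
    and "degree p \<le> n"
    and "p = (\<Sum>j=0..n. smult (b j) (qEuler q r j))"
    and "k \<le> n"
  shows
    "b k = 1 / (2 ^ r * of_real (qfact q k)) * qfunctional q ((qexp q + 1) ^ r * fps_X ^ k) p
     \<and> summable (\<lambda>m. \<Sum>l=0..r. of_nat (r choose l) *
           (\<Sum>is | length is = l \<and> sum_list is = m.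
              of_real (qmultinomial q m is) * (1 / of_real (qfact q m)) *
              (qderiv q ^^ (m + k)) (poly p) 0))
     \<and> 1 / (2 ^ r * of_real (qfact q k)) * qfunctional q ((qexp q + 1) ^ r * fps_X ^ k) p
       = 1 / (2 ^ r * of_real (qfact q k)) *
         (\<Sum>m. \<Sum>l=0..r. of_nat (r choose l) *
           (\<Sum>is | length is = l \<and> sum_list is = m.
              of_real (qmultinomial q m is) * (1 / of_real (qfact q m)) *
              (qderiv q ^^ (m + k)) (poly p) 0))"
proof -
  let ?F = "qfunctional q ((qexp q + 1) ^ r * fps_X ^ k) p"
  have nz: "qfact q k \<noteq> 0"
    using qfact_pos[OF assms(1,2), of k] by simp
  \<comment> \<open>Biorthogonality isolates the term \<open>j = k\<close>, which lies in the range
    because \<open>k \<le> n\<close>.\<close>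
  have "?F = (\<Sum>j=0..n. if j = k then b k * (2 ^ r * of_real (qfact q k)) else 0)"
    unfolding assms(4) qfunctional_sum qfunctional_smult
      qfunctional_qEuler_biorthogonal[OF assms(1,2)]
    by (rule sum.cong) auto
  then have b: "b k = 1 / (2 ^ r * of_real (qfact q k)) * ?F"
    using assms(5) nz by simp
  \<comment> \<open>Stated with \<open>sums\<close>, this gives both the convergence and the value
    of the series.\<close>
  have "(\<lambda>m. \<Sum>l=0..r. of_nat (r choose l) *
           (\<Sum>is | length is = l \<and> sum_list is = m.
              of_real (qmultinomial q m is) * (1 / of_real (qfact q m)) *
              (qderiv q ^^ (m + k)) (poly p) 0)) sums ?F"
    using qfunctional_mult_X_power_sums[OF assms(1,2), of "(qexp q + 1) ^ r" k p]
    by (simp only: fps_nth_qexp_plus_one_power[OF assms(1,2)] sum_distrib_right mult.assoc)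
  with b show ?thesis
    by (auto simp: sums_iff)
qed

end
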